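(* Let $c>0$ be a real number. Let $\mathcal{C}_{\le cn}$ be the family of all cycles of length at most $cn$ and let $P_n$ be the path on $n$ vertices. Then for all sufficiently large $n$, $$\hat{R}(\mathcal{C}_{\le cn},P_n) \ge 2.00365\, n.$$
   Context: All graphs are finite and simple. For a family of graphs $\mathcal{F}$ and a graph $H$, write $G\to(\mathcal{F},H)$ if every colouring of the edges of $G$ with two colours, red and blue, yields a red copy (as a not necessarily induced subgraph) of some graph from $\mathcal{F}$ or a blue copy of $H$. The size-Ramsey number is $\hat{R}(\mathcal{F},H)=\min\{|E(G)| : G\to(\mathcal{F},H)\}$, with the convention that the minimum of the empty set is $+\infty$; so the claim says that every $G$ with $G\to(\mathcal{C}_{\le cn},P_n)$ has at least $2.00365\,n$ edges. *)

theory Defs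
  imports Complex_Main "HOL-Library.Extended_Real"
begin

record 'a ugraph =
  verts :: "'a set"
  edges :: "'a set set"

definition simple_graph :: "'a ugraph \<Rightarrow> bool" where
  "simple_graph G \<longleftrightarrow>
     finite (verts G) \<and> (\<forall>e\<in>edges G. e \<subseteq> verts G \<and> card e = 2)"

(* G contains a copy of H as a subgraph that need not be induced *)
definition contains_copy :: "'a ugraph \<Rightarrow> 'b ugraph \<Rightarrow> bool" where
  "contains_copy G H \<longleftrightarrow>
     (\<exists>f. inj_on f (verts H) \<and> f ` verts H \<subseteq> verts G \<and> (\<forall>e\<in>edges H. f ` e \<in> edges G))"

datatype colour = Red | Blue

(* Colourings are total functions; only their values on the edges of G matter. *)
definition colour_subgraph :: "'a ugraph \<Rightarrow> ('a set \<Rightarrow> colour) \<Rightarrow> colour \<Rightarrow> 'a ugraph" where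
  "colour_subgraph G \<chi> col = \<lparr>verts = verts G, edges = {e \<in> edges G. \<chi> e = col}\<rparr>"

definition ramsey_arrows :: "'a ugraph \<Rightarrow> 'b ugraph set \<Rightarrow> 'c ugraph \<Rightarrow> bool" where
  "ramsey_arrows G \<F> H \<longleftrightarrow>
     (\<forall>\<chi>. (\<exists>F\<in>\<F>. contains_copy (colour_subgraph G \<chi> Red) F) \<or>
          contains_copy (colour_subgraph G \<chi> Blue) H)"

(* Graphs on subsets of nat represent all finite graphs up to isomorphism (see
   size_ramsey_le below).  In enat a nonempty set attains its infimum, and the
   infimum of the empty set is \<infinity>. *)
definition size_ramsey :: "'b ugraph set \<Rightarrow> 'c ugraph \<Rightarrow> enat" where
  "size_ramsey \<F> H =
     Inf {enat (card (edges G)) | G :: nat ugraph. simple_graph G \<and> ramsey_arrows G \<F> H}"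

definition path_graph :: "nat \<Rightarrow> nat ugraph" where
  "path_graph n = \<lparr>verts = {..<n}, edges = {{i, Suc i} | i. Suc i < n}\<rparr>"

(* a cycle only for k \<ge> 3 *)
definition cycle_graph :: "nat \<Rightarrow> nat ugraph" where
  "cycle_graph k = \<lparr>verts = {..<k}, edges = {{i, Suc i mod k} | i. i < k}\<rparr>"

(* one representative of each isomorphism class, which suffices for containing copies *)
definition cycles_upto :: "real \<Rightarrow> nat ugraph set" where
  "cycles_upto x = {cycle_graph k | k. 3 \<le> k \<and> real k \<le> x}"

lemma simple_graph_path_graph: "simple_graph (path_graph n)"
  by (auto simp: simple_graph_def path_graph_def)

lemma simple_graph_cycle_graph:
  assumes "3 \<le> k"
  shows "simple_graph (cycle_graph k)"
proof -
  have "card {i, Suc i mod k} = 2" if "i < k" for i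
  proof -
    have "Suc i mod k \<noteq> i"
      using that assms by (cases "Suc i = k") auto
    then show ?thesis by simp
  qed
  then show ?thesis
    using assms by (auto simp: simple_graph_def cycle_graph_def)
qed

lemma contains_copy_image:
  fixes g :: "'a \<Rightarrow> 'b"
  assumes g: "inj_on g (verts G)"
    and copy: "contains_copy (colour_subgraph G (\<lambda>e. \<chi> (g ` e)) col) K"
  shows "contains_copy (colour_subgraph \<lparr>verts = g ` verts G, edges = (`) g ` edges G\<rparr> \<chi> col) K"
proof -
  obtain f where f: "inj_on f (verts K)" "f ` verts K \<subseteq> verts G"
    "\<forall>e\<in>edges K. f ` e \<in> edges G \<and> \<chi> (g ` f ` e) = col"
    using copy by (auto simp: contains_copy_def colour_subgraph_def)
  have "inj_on (g \<circ> f) (verts K)"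
    by (rule comp_inj_on[OF f(1) inj_on_subset[OF g f(2)]])
  moreover have "(g \<circ> f) ` verts K \<subseteq> g ` verts G"
    using f by auto
  moreover have "\<forall>e\<in>edges K. (g \<circ> f) ` e \<in> (`) g ` edges G \<and> \<chi> ((g \<circ> f) ` e) = col"
    using f(3) unfolding image_comp[symmetric] by blast
  ultimately show ?thesis
    unfolding contains_copy_def colour_subgraph_def by (intro exI[of _ "g \<circ> f"]) simp
qed

lemma size_ramsey_le:
  fixes G :: "'a ugraph"
  assumes G: "simple_graph G" and arr: "ramsey_arrows G \<F> H"
  shows "size_ramsey \<F> H \<le> enat (card (edges G))"
proof -
  have fin: "finite (verts G)" using G by (simp add: simple_graph_def)
  obtain g :: "'a \<Rightarrow> nat" where g: "inj_on g (verts G)"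
    using finite_imp_inj_to_nat_seg[OF fin] by blast
  define G' where "G' = \<lparr>verts = g ` verts G, edges = (`) g ` edges G\<rparr>"
  have sub: "e \<subseteq> verts G" if "e \<in> edges G" for e
    using G that by (simp add: simple_graph_def)
  have inj: "inj_on ((`) g) (edges G)"
    using sub by (intro inj_onI) (simp add: inj_on_image_eq_iff[OF g])
  have simple: "simple_graph G'"
    unfolding simple_graph_def G'_def
  proof (simp, intro conjI ballI)
    show "finite (g ` verts G)" using fin by simp
    fix e assume e: "e \<in> edges G"
    show "g ` e \<subseteq> g ` verts G" using sub[OF e] by blast
    have "card (g ` e) = card e"
      by (rule card_image) (rule inj_on_subset[OF g sub[OF e]])
    then show "card (g ` e) = 2" using G e by (simp add: simple_graph_def)
  qed
  have "ramsey_arrows G' \<F> H"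
    unfolding ramsey_arrows_def
  proof
    fix \<chi> :: "nat set \<Rightarrow> colour"
    have "(\<exists>F\<in>\<F>. contains_copy (colour_subgraph G (\<lambda>e. \<chi> (g ` e)) Red) F) \<or>
          contains_copy (colour_subgraph G (\<lambda>e. \<chi> (g ` e)) Blue) H"
      using arr unfolding ramsey_arrows_def by (rule spec)
    then show "(\<exists>F\<in>\<F>. contains_copy (colour_subgraph G' \<chi> Red) F) \<or>
          contains_copy (colour_subgraph G' \<chi> Blue) H"
      unfolding G'_def by (auto intro: contains_copy_image[OF g])
  qed
  moreover have "card (edges G') = card (edges G)"
    using card_image[OF inj] by (simp add: G'_def)
  ultimately show ?thesis
    unfolding size_ramsey_def using simple
    by (intro Inf_lower CollectI exI[of _ G']) simp
qed

end

(* Colour a forest T red and all other edges blue. Component by component we may assume that G is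
   connected, with N \<ge> n vertices and m edges. If T is a spanning tree, then a blue path on n
   vertices needs n - 1 \<le> m - N + 1, and it misses all but two of the vertices whose blue degree
   is at most 1; so at most N - n + 2 \<le> m - 2n + 4 vertices have blue degree at most 1.

   To force many such vertices, greedily collect almost complete stars into a forest F that T
   extends: a vertex v of degree at most 4 outside the set U of vertices used so far can be added
   if at most two of its neighbours are in U, by taking its edges to vertices outside U and one of
   its edges to U. If this stops after k steps, then |U| \<le> 5k, and every vertex outside U has
   degree at least 5 or at least 3 neighbours in U. Counting an edge twice for its endpoint outside
   U if its other endpoint is in U gives 2m \<ge> 5 (N - 5k). With k \<le> N - n + 2 \<le> m - 2n + 4
   this fails for m \<le> (2 + \<epsilon>) n if \<epsilon> < 1/22 and n is large. *)
theory Submission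
  imports Defs
begin

section \<open>Forests, cuts and paths as sets of edges\<close>

text \<open>For finite sets of two-element edges this is acyclicity: a cycle has as many edges as
  vertices, a nonempty acyclic edge set has fewer. The counting form is inherited by subsets and
  needs no notion of walk.\<close>

definition is_forest :: "'a set set \<Rightarrow> bool" where
  "is_forest F \<longleftrightarrow> (\<forall>S\<subseteq>F. S \<noteq> {} \<longrightarrow> card S < card (\<Union>S))"

text \<open>Connectivity is expressed through cuts only: every nonempty proper vertex subset is
  crossed by some edge.\<close>

definition crosses :: "'a set \<Rightarrow> 'a set \<Rightarrow> bool" where
  "crosses e X \<longleftrightarrow> e \<inter> X \<noteq> {} \<and> \<not> e \<subseteq> X"

definition path_in :: "'a set set \<Rightarrow> nat \<Rightarrow> (nat \<Rightarrow> 'a) \<Rightarrow> bool" where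
  "path_in B n f \<longleftrightarrow> inj_on f {..<n} \<and> (\<forall>i. Suc i < n \<longrightarrow> {f i, f (Suc i)} \<in> B)"

lemma path_in_eq_iff: "path_in B n f \<Longrightarrow> i < n \<Longrightarrow> j < n \<Longrightarrow> f i = f j \<longleftrightarrow> i = j"
  by (auto simp: path_in_def inj_on_def)

lemma is_forest_empty: "is_forest {}"
  by (simp add: is_forest_def)

lemma is_forest_card_le: "is_forest F \<Longrightarrow> S \<subseteq> F \<Longrightarrow> card S \<le> card (\<Union>S)"
  unfolding is_forest_def by (metis card.empty less_imp_le zero_le)

lemma is_forest_union:
  assumes F: "is_forest F1" "is_forest F2"
    and fin: "finite (\<Union>F1)" "finite (\<Union>F2)" and disj: "\<Union>F1 \<inter> \<Union>F2 = {}"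
  shows "is_forest (F1 \<union> F2)"
  unfolding is_forest_def
proof (intro allI impI)
  fix S assume S: "S \<subseteq> F1 \<union> F2" "S \<noteq> {}"
  define A B where "A = S \<inter> F1" and "B = S \<inter> F2"
  have AB: "S = A \<union> B" "A \<subseteq> F1" "B \<subseteq> F2"
    using S by (auto simp: A_def B_def)
  have US: "\<Union>S = \<Union>A \<union> \<Union>B" using AB by auto
  have "card (\<Union>S) = card (\<Union>A) + card (\<Union>B)"
    unfolding US
  proof (rule card_Un_disjoint)
    show "finite (\<Union>A)" "finite (\<Union>B)"
      using AB fin by (meson Union_mono finite_subset)+
    show "\<Union>A \<inter> \<Union>B = {}" using AB disj by blast
  qed
  moreover have "card S \<le> card A + card B" using AB card_Un_le by blast
  moreover have "card A \<le> card (\<Union>A)" "card B \<le> card (\<Union>B)"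
    using AB F is_forest_card_le by blast+
  moreover have "card A < card (\<Union>A) \<or> card B < card (\<Union>B)"
    using AB F S unfolding is_forest_def by (metis sup_bot_left)
  ultimately show "card S < card (\<Union>S)" by linarith
qed

text \<open>The new edge is the only one across the cut \<open>X\<close>. Without it, an edge set
  splits into a part inside \<open>X\<close> and a part disjoint from \<open>X\<close>. Adjoining
  \<open>x\<close> to the vertices of one part and \<open>y\<close> to those of the other leaves
  each with a surplus of at least one vertex, and the total surplus of two pays for the new
  edge.\<close>

lemma is_forest_insert:
  assumes F: "is_forest F" and fin: "finite (\<Union>F)"
    and cut: "\<And>e. e \<in> F \<Longrightarrow> \<not> crosses e X"
    and x: "x \<in> X" and y: "y \<notin> X"
  shows "is_forest (insert {x, y} F)"
  unfolding is_forest_def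
proof (intro allI impI)
  fix S assume S: "S \<subseteq> insert {x, y} F" "S \<noteq> {}"
  show "card S < card (\<Union>S)"
  proof (cases "{x, y} \<in> S")
    case False
    then show ?thesis using S F unfolding is_forest_def by blast
  next
    case True
    define A B where "A = {e \<in> S - {{x, y}}. e \<subseteq> X}" and "B = {e \<in> S - {{x, y}}. \<not> e \<subseteq> X}"
    have AB: "S = insert {x, y} (A \<union> B)" "A \<subseteq> F" "B \<subseteq> F"
      using S True by (auto simp: A_def B_def)
    have BX: "\<Union>B \<inter> X = {}"
      using AB(3) cut by (auto simp: B_def crosses_def)
    have AX: "\<Union>A \<subseteq> X" by (auto simp: A_def)
    have finA: "finite (\<Union>A)" and finB: "finite (\<Union>B)"
      using AB fin by (meson Union_mono finite_subset)+
    have US: "\<Union>S = insert x (\<Union>A) \<union> insert y (\<Union>B)" using AB(1) by auto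
    have "card (\<Union>S) = card (insert x (\<Union>A)) + card (insert y (\<Union>B))"
      unfolding US by (rule card_Un_disjoint) (use finA finB AX BX x y in auto)
    \<comment> \<open>An empty part has no vertices of its own; the adjoined endpoint supplies the
      surplus.\<close>
    moreover have "card A < card (insert x (\<Union>A))" if "A \<subseteq> F" "finite (\<Union>A)" for A x
    proof (cases "A = {}")
      case False
      then have "card A < card (\<Union>A)" using F that unfolding is_forest_def by blast
      also have "\<dots> \<le> card (insert x (\<Union>A))" using that by (intro card_mono) auto
      finally show ?thesis .
    qed simp
    then have "card A < card (insert x (\<Union>A))" "card B < card (insert y (\<Union>B))"
      using AB finA finB by blast+
    moreover have "card S \<le> Suc (card A + card B)"
      using card_Un_le[of "{{x, y}}" "A \<union> B"] card_Un_le[of A B] AB(1) by simp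
    ultimately show ?thesis by linarith
  qed
qed

text \<open>The k edges are distinct but cover only k vertices.\<close>

lemma is_forest_no_cycle:
  assumes F: "is_forest F" and k: "3 \<le> k"
    and inj: "inj_on f {..<k}" and sub: "\<And>i. i < k \<Longrightarrow> {f i, f (Suc i mod k)} \<in> F"
  shows False
proof -
  let ?e = "\<lambda>i. {f i, f (Suc i mod k)}"
  let ?S = "?e ` {..<k}"
  have "inj_on ?e {..<k}"
  proof (rule inj_onI)
    fix i j assume ij: "i \<in> {..<k}" "j \<in> {..<k}" "?e i = ?e j"
    have lt: "Suc i mod k < k" "Suc j mod k < k" using k by auto
    have "f i = f j \<or> (f i = f (Suc j mod k) \<and> f j = f (Suc i mod k))"
      using ij(3) by (auto simp: doubleton_eq_iff)
    then have "i = j \<or> (i = Suc j mod k \<and> j = Suc i mod k)"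
      using inj ij lt by (auto simp: inj_on_def)
    \<comment> \<open>The crossed alternative would give i = i + 2 modulo k, impossible for k \<ge>
      3.\<close>
    then show "i = j"
      using k ij by (cases "Suc i = k"; cases "Suc j = k") auto
  qed
  then have "card ?S = k" by (simp add: card_image)
  moreover have "\<Union>?S \<subseteq> f ` {..<k}" using k by auto
  then have "card (\<Union>?S) \<le> card (f ` {..<k})" by (rule card_mono[rotated]) simp
  moreover have "card (f ` {..<k}) = k" using card_image[OF inj] by simp
  moreover have "?S \<subseteq> F" using sub by auto
  moreover have "?S \<noteq> {}" using k by (simp add: lessThan_empty_iff)
  then have "card ?S < card (\<Union>?S)"
    using F[unfolded is_forest_def, rule_format, OF \<open>?S \<subseteq> F\<close>] by blast
  ultimately show False by linarith
qed

text \<open>The leaves are attached one at a time. A leaf not yet covered is isolated, so the cut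
  consisting of that leaf alone is uncrossed.\<close>

lemma is_forest_add_star:
  assumes "finite S" "is_forest F" "finite (\<Union>F)" "S \<inter> \<Union>F = {}" "v \<notin> S"
  shows "is_forest ((\<lambda>w. {w, v}) ` S \<union> F)"
  using assms
proof (induction S rule: finite_induct)
  case (insert w S)
  have "is_forest (insert {w, v} ((\<lambda>w. {w, v}) ` S \<union> F))"
  proof (rule is_forest_insert[where X = "{w}"])
    show "is_forest ((\<lambda>w. {w, v}) ` S \<union> F)" using insert by auto
    show "finite (\<Union>((\<lambda>w. {w, v}) ` S \<union> F))" using insert by auto
    show "\<not> crosses e {w}" if "e \<in> (\<lambda>w. {w, v}) ` S \<union> F" for e
      using that insert by (auto simp: crosses_def)
  qed (use insert in auto)
  then show ?case by simp
qed simp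

section \<open>Spanning trees of connected graphs\<close>

text \<open>A vertex set is grown from a single vertex along crossing edges; each new vertex brings
  at least one new edge inside the set.\<close>

lemma connected_card_edges:
  assumes fin: "finite V" "finite T"
    and conn: "\<And>X. X \<subseteq> V \<Longrightarrow> X \<noteq> {} \<Longrightarrow> X \<noteq> V \<Longrightarrow> \<exists>e\<in>T. crosses e X"
    and T: "\<And>e. e \<in> T \<Longrightarrow> e \<subseteq> V \<and> card e = 2"
  shows "card V \<le> Suc (card T)"
proof -
  have grow: "\<exists>X\<subseteq>V. card X = Suc i \<and> i \<le> card {e \<in> T. e \<subseteq> X}" if "i < card V" for i
    using that
  proof (induction i)
    case 0
    then obtain v where "v \<in> V" by fastforce
    then show ?case by (intro exI[of _ "{v}"]) auto
  next
    case (Suc i)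
    then obtain X where X: "X \<subseteq> V" "card X = Suc i" "i \<le> card {e \<in> T. e \<subseteq> X}"
      by auto
    then obtain e where e: "e \<in> T" "crosses e X"
      using conn[of X] Suc.prems by force
    then obtain x y where xy: "x \<in> X" "y \<notin> X" "{x, y} \<subseteq> e" by (auto simp: crosses_def)
    have "card e = 2" using T e by blast
    then have exy: "e = {x, y}"
      using xy by (metis card_2_iff card_seteq card.infinite finite.emptyI finite.insertI
          order_refl zero_neq_numeral)
    have finX: "finite X" using X fin finite_subset by blast
    have "Suc (card {e \<in> T. e \<subseteq> X}) = card (insert e {e \<in> T. e \<subseteq> X})"
      using fin exy xy by simp
    also have "\<dots> \<le> card {e \<in> T. e \<subseteq> insert y X}"
      by (rule card_mono) (use fin e exy xy in auto)
    finally have "Suc i \<le> card {e \<in> T. e \<subseteq> insert y X}" using X by simp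
    moreover have "insert y X \<subseteq> V" using X e exy T by blast
    moreover have "card (insert y X) = Suc (Suc i)" using X xy finX by simp
    ultimately show ?case by blast
  qed
  show ?thesis
  proof (cases "card V = 0")
    case False
    then obtain X where "card V - 1 \<le> card {e \<in> T. e \<subseteq> X}"
      using grow[of "card V - 1"] by auto
    also have "\<dots> \<le> card T" by (rule card_mono[OF fin(2)]) auto
    finally show ?thesis by simp
  qed simp
qed

text \<open>\<open>T\<close> is a maximal forest between \<open>F\<close> and \<open>E\<close>. If
  \<open>T\<close> left a cut uncrossed, an edge of \<open>E\<close> across that cut could be added
  to it. Only the lower bound on the size of \<open>T\<close> is recorded, since it bounds the
  number of blue edges from above.\<close>

lemma forest_extends_to_spanning_tree:
  assumes fin: "finite V" "finite E" and E: "\<And>e. e \<in> E \<Longrightarrow> e \<subseteq> V \<and> card e = 2"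
    and conn: "\<And>X. X \<subseteq> V \<Longrightarrow> X \<noteq> {} \<Longrightarrow> X \<noteq> V \<Longrightarrow> \<exists>e\<in>E. crosses e X"
    and F: "is_forest F" "F \<subseteq> E"
  obtains T where "is_forest T" "F \<subseteq> T" "T \<subseteq> E" "card V \<le> Suc (card T)"
proof -
  let ?P = "{T. is_forest T \<and> F \<subseteq> T \<and> T \<subseteq> E}"
  have finP: "finite ?P" by (rule finite_subset[of _ "Pow E"]) (use fin in auto)
  have "F \<in> ?P" using F by simp
  from finite_has_maximal2[OF finP this]
  obtain T where "T \<in> ?P" and max: "\<forall>T'\<in>?P. T \<subseteq> T' \<longrightarrow> T = T'" by (elim bexE conjE)
  then have T: "is_forest T" "F \<subseteq> T" "T \<subseteq> E" by simp_all
  have "\<exists>e\<in>T. crosses e X" if X: "X \<subseteq> V" "X \<noteq> {}" "X \<noteq> V" for X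
  proof (rule ccontr)
    assume no: "\<not> (\<exists>e\<in>T. crosses e X)"
    obtain e where e: "e \<in> E" "crosses e X" using conn X by blast
    obtain a b where "e = {a, b}" using E e by (metis card_2_iff)
    then obtain x y where xy: "e = {x, y}" "x \<in> X" "y \<notin> X"
      using e by (auto simp: crosses_def)
    have "finite (\<Union>T)" by (rule finite_subset[OF _ fin(1)]) (use T(3) E in blast)
    then have "is_forest (insert e T)"
      unfolding xy(1) using T no xy by (intro is_forest_insert[where X = X]) auto
    then have "insert e T \<in> ?P" using T e by auto
    with max have "T = insert e T" by (auto dest: bspec)
    then show False using no e by blast
  qed
  moreover have "finite T" using T fin finite_subset by blast
  moreover have "e \<subseteq> V \<and> card e = 2" if "e \<in> T" for e using that T E by blast
  ultimately have "card V \<le> Suc (card T)"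
    using fin by (intro connected_card_edges) blast+
  then show ?thesis using that T by blast
qed

section \<open>Edges and degrees along a path\<close>

lemma path_in_card_edges:
  assumes "path_in B n f" "finite B"
  shows "n \<le> Suc (card B)"
proof -
  have "inj_on (\<lambda>i. {f i, f (Suc i)}) {..<n - 1}"
  proof (rule inj_onI)
    fix i j assume ij: "i \<in> {..<n - 1}" "j \<in> {..<n - 1}" "{f i, f (Suc i)} = {f j, f (Suc j)}"
    then have "f i = f j \<or> f i = f (Suc j) \<and> f (Suc i) = f j"
      by (auto simp: doubleton_eq_iff)
    then show "i = j"
      using ij by (auto simp: path_in_eq_iff[OF assms(1)])
  qed
  moreover have "(\<lambda>i. {f i, f (Suc i)}) ` {..<n - 1} \<subseteq> B"
    using assms by (auto simp: path_in_def)
  ultimately have "card {..<n - 1} \<le> card B"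
    using assms card_inj_on_le by blast
  then show ?thesis by simp
qed

lemma path_in_interior_degree:
  assumes "path_in B n f" "finite B" "0 < i" "Suc i < n"
  shows "2 \<le> card {e \<in> B. f i \<in> e}"
proof -
  obtain j where j: "i = Suc j" using assms by (cases i) auto
  have "{f j, f i} \<noteq> {f i, f (Suc i)}"
    using assms j by (simp add: doubleton_eq_iff path_in_eq_iff[OF assms(1)])
  then have "card {{f j, f i}, {f i, f (Suc i)}} = 2" by simp
  moreover have "card {{f j, f i}, {f i, f (Suc i)}} \<le> card {e \<in> B. f i \<in> e}"
    by (rule card_mono) (use assms j in \<open>auto simp: path_in_def\<close>)
  ultimately show ?thesis by simp
qed

text \<open>Interior vertices of the path have degree at least 2 in \<open>B\<close>, so
  \<open>K\<close> can meet the path only in its two ends.\<close>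

lemma path_in_low_degree:
  assumes path: "path_in B n f" and fin: "finite B" "finite V" and V: "f ` {..<n} \<subseteq> V"
    and K: "K \<subseteq> V" "\<And>v. v \<in> K \<Longrightarrow> card {e \<in> B. v \<in> e} \<le> 1"
  shows "card K + n \<le> card V + 2"
proof -
  let ?I = "f ` {1..<n - 1}"
  have "f i \<notin> K" if "i \<in> {1..<n - 1}" for i
    using K(2)[of "f i"] path_in_interior_degree[OF path fin(1), of i] that by force
  then have "K \<inter> ?I = {}" by blast
  moreover have "?I \<subseteq> f ` {..<n}" by auto
  then have "?I \<subseteq> V" using V by (rule order_trans)
  moreover have "inj_on f {1..<n - 1}"
    by (rule inj_on_subset[of _ "{..<n}"]) (use path in \<open>auto simp: path_in_def\<close>)
  \<comment> \<open>Truncated subtraction is harmless for n < 2, because n \<le> (n - 2) + 2 still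
    holds.\<close>
  then have "card ?I = n - 2" by (simp add: card_image)
  moreover have "finite K" using K fin finite_subset by blast
  ultimately have "card (K \<union> ?I) = card K + (n - 2)" "K \<union> ?I \<subseteq> V"
    using K by (simp_all add: card_Un_disjoint)
  with card_mono[OF fin(2) this(2)] show ?thesis by simp
qed

section \<open>Weighted degree counting and greedy star packing\<close>

text \<open>Double counting: an edge avoiding \<open>U\<close> counts once for each of its at most
  two ends in \<open>W\<close>; an edge meeting \<open>U\<close> has at most one end in
  \<open>W\<close> and counts twice there.\<close>

lemma weighted_degree_sum:
  assumes fin: "finite V" "finite E" and E: "\<And>e. e \<in> E \<Longrightarrow> card e = 2" and W: "W \<subseteq> V" "W \<inter> U = {}"
  shows "(\<Sum>v\<in>W. card {e \<in> E. v \<in> e} + card {e \<in> E. v \<in> e \<and> e \<inter> U \<noteq> {}}) \<le> 2 * card E"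
proof -
  have finW: "finite W" using fin W finite_subset by blast
  have "(\<Sum>v\<in>W. card {e \<in> E. v \<in> e} + card {e \<in> E. v \<in> e \<and> e \<inter> U \<noteq> {}})
      = (\<Sum>v\<in>W. \<Sum>e\<in>E. of_bool (v \<in> e) + of_bool (v \<in> e \<and> e \<inter> U \<noteq> {}))"
    using fin by (intro sum.cong) (simp_all add: sum.distrib Int_def)
  also have "\<dots> = (\<Sum>e\<in>E. \<Sum>v\<in>W. of_bool (v \<in> e) + of_bool (v \<in> e \<and> e \<inter> U \<noteq> {}))"
    by (rule sum.swap)
  also have "\<dots> \<le> (\<Sum>e\<in>E. 2)"
  proof (rule sum_mono)
    fix e assume e: "e \<in> E"
    have fe: "finite e" using E[OF e] by (metis card.infinite zero_neq_numeral)
    have eq: "(\<Sum>v\<in>W. of_bool (v \<in> e) + of_bool (v \<in> e \<and> e \<inter> U \<noteq> {}) :: nat)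
      = card (W \<inter> e) * (if e \<inter> U = {} then 1 else 2)"
      using finW by (simp add: sum.distrib Int_def)
    have "card (W \<inter> e) \<le> 2"
      using card_mono[OF fe, of "W \<inter> e"] E[OF e] by simp
    moreover have "card (W \<inter> e) < 2" if "e \<inter> U \<noteq> {}"
    proof -
      have "W \<inter> e \<subset> e" using that W by blast
      from psubset_card_mono[OF fe this] show ?thesis using E[OF e] by simp
    qed
    ultimately show "(\<Sum>v\<in>W. of_bool (v \<in> e) + of_bool (v \<in> e \<and> e \<inter> U \<noteq> {})) \<le> (2 :: nat)"
      unfolding eq by (cases "e \<inter> U = {}") auto
  qed
  finally show ?thesis by simp
qed

text \<open>In a triple \<open>(K, U, F)\<close>, the set \<open>K\<close> holds the centres of the stars collected so far.\<close>

definition star_packing :: "'a set \<Rightarrow> 'a set set \<Rightarrow> 'a set \<Rightarrow> 'a set \<Rightarrow> 'a set set \<Rightarrow> bool" where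
  "star_packing V E K U F \<longleftrightarrow> K \<subseteq> U \<and> U \<subseteq> V \<and> card U \<le> 5 * card K \<and>
     F \<subseteq> E \<and> \<Union>F \<subseteq> U \<and> is_forest F \<and> (\<forall>v\<in>K. card {e \<in> E - F. v \<in> e} \<le> 1)"

text \<open>\<open>U\<close> gains \<open>v\<close> and its at most 4 neighbours outside
  \<open>U\<close>, which accounts for the factor 5 in \<open>star_packing\<close>. Degrees outside
  the forest at old centres cannot increase, as the forest only grows.\<close>

lemma star_packing_extend:
  assumes fin: "finite V" "finite E" and E: "\<And>e. e \<in> E \<Longrightarrow> e \<subseteq> V \<and> card e = 2"
    and P: "star_packing V E K U F" and v: "v \<in> V" "v \<notin> U"
    and d: "card {e \<in> E. v \<in> e} \<le> 4" and u: "card {e \<in> E. v \<in> e \<and> e \<inter> U \<noteq> {}} \<le> 2"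
  shows "\<exists>U' F'. star_packing V E (insert v K) U' F'"
proof -
  have K: "K \<subseteq> U" "U \<subseteq> V" "card U \<le> 5 * card K" "F \<subseteq> E" "\<Union>F \<subseteq> U" "is_forest F"
    "\<And>w. w \<in> K \<Longrightarrow> card {e \<in> E - F. w \<in> e} \<le> 1"
    using P by (auto simp: star_packing_def)
  have finU: "finite U" using K fin finite_subset by blast
  define S where "S = {w. {w, v} \<in> E \<and> w \<notin> U}"
  define R where "R = {e \<in> E. v \<in> e \<and> e \<inter> U \<noteq> {}}"
  have edge: "\<exists>w. w \<noteq> v \<and> e = {w, v}" if "e \<in> E" "v \<in> e" for e
    using E that by (metis card_2_iff doubleton_eq_iff insert_iff singletonD)
  have vS: "v \<notin> S" using E[of "{v, v}"] by (auto simp: S_def)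
  have SV: "S \<subseteq> V" using E by (auto simp: S_def)
  have finS: "finite S" using SV fin finite_subset by blast
  have finR: "finite R" using fin by (simp add: R_def)
  have cardS: "card S \<le> 4"
  proof -
    have "inj_on (\<lambda>w. {w, v}) S" by (auto simp: inj_on_def doubleton_eq_iff)
    then have "card S \<le> card {e \<in> E. v \<in> e}"
      by (rule card_inj_on_le) (use fin in \<open>auto simp: S_def\<close>)
    then show ?thesis using d by simp
  qed
  have star: "{e \<in> E. v \<in> e} \<subseteq> (\<lambda>w. {w, v}) ` S \<union> R"
  proof
    fix e assume e: "e \<in> {e \<in> E. v \<in> e}"
    then obtain w where w: "w \<noteq> v" "e = {w, v}" using edge by blast
    show "e \<in> (\<lambda>w. {w, v}) ` S \<union> R"
      using e w v by (cases "w \<in> U") (auto simp: S_def R_def)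
  qed
  \<comment> \<open>\<open>R0\<close> consists of one edge from \<open>v\<close> into
    \<open>U\<close>, if there is any. A second such edge might close a cycle, and since
    \<open>R\<close> has at most two elements, at most one edge at \<open>v\<close> is left
    out.\<close>
  obtain R0 where R0: "R0 \<subseteq> R" "card (R - R0) \<le> 1" "is_forest (R0 \<union> F)"
  proof (cases "R = {}")
    case True
    then show ?thesis using that[of "{}"] K by simp
  next
    case False
    then obtain r where r: "r \<in> R" by blast
    then obtain w where w: "w \<noteq> v" "r = {v, w}" using edge by (fastforce simp: R_def)
    have "is_forest (insert r F)"
      unfolding w(2)
      by (rule is_forest_insert[where X = "{v}"])
        (use K v w finU finite_subset in \<open>auto simp: crosses_def\<close>)
    moreover have "card (R - {r}) \<le> 1" using r u finR unfolding R_def[symmetric] by simp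
    ultimately show ?thesis using that[of "{r}"] r by simp
  qed
  have R0U: "\<Union>R0 \<subseteq> insert v U"
  proof -
    have "e \<subseteq> insert v U" if "e \<in> R" for e
      using that edge v unfolding R_def by fastforce
    then show ?thesis using R0 by blast
  qed
  define F' where "F' = (\<lambda>w. {w, v}) ` S \<union> (R0 \<union> F)"
  define U' where "U' = insert v S \<union> U"
  have R0F: "\<Union>(R0 \<union> F) \<subseteq> insert v U" using R0U K by auto
  have "is_forest F'"
    unfolding F'_def
  proof (rule is_forest_add_star)
    show "finite (\<Union>(R0 \<union> F))" using R0F finU finite_subset by blast
    show "S \<inter> \<Union>(R0 \<union> F) = {}" using R0F vS by (auto simp: S_def)
  qed (use finS R0 vS in auto)
  moreover have "F' \<subseteq> E" using K R0 by (auto simp: F'_def S_def R_def)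
  moreover have "\<Union>F' \<subseteq> U'" using R0F by (auto simp: F'_def U'_def)
  moreover have "U' \<subseteq> V" using K SV v by (auto simp: U'_def)
  moreover have "insert v K \<subseteq> U'" using K by (auto simp: U'_def)
  moreover have "card U' \<le> 5 * card (insert v K)"
  proof -
    have "card U' \<le> card (insert v S) + card U" unfolding U'_def by (rule card_Un_le)
    moreover have "card (insert v S) \<le> 5" using cardS vS finS by simp
    moreover have "card (insert v K) = Suc (card K)"
      using K v finU finite_subset by (metis card_insert_disjoint subsetD)
    ultimately show ?thesis using K by simp
  qed
  moreover have "card {e \<in> E - F'. w \<in> e} \<le> 1" if "w \<in> insert v K" for w
  proof (cases "w = v")
    case True
    have "{e \<in> E - F'. v \<in> e} \<subseteq> R - R0" using star by (auto simp: F'_def)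
    then show ?thesis using True R0 finR by (metis card_mono finite_Diff order_trans)
  next
    case False
    have "card {e \<in> E - F'. w \<in> e} \<le> card {e \<in> E - F. w \<in> e}"
      by (rule card_mono) (use fin in \<open>auto simp: F'_def\<close>)
    then show ?thesis using False that K(7)[of w] by simp
  qed
  ultimately have "star_packing V E (insert v K) U' F'" unfolding star_packing_def by simp
  then show ?thesis by blast
qed

text \<open>For a maximal set \<open>K\<close> of centres, every vertex outside \<open>U\<close> has
  weight at least 5 in the double count, and \<open>U\<close> has at most 5 |K| vertices.\<close>

lemma large_star_packing:
  assumes fin: "finite V" "finite E" and E: "\<And>e. e \<in> E \<Longrightarrow> e \<subseteq> V \<and> card e = 2"
  obtains K U F where "star_packing V E K U F" "5 * card V \<le> 2 * card E + 25 * card K"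
proof -
  let ?P = "\<lambda>K. \<exists>U F. star_packing V E K U F"
  have finP: "finite {K. ?P K}"
    using fin by (auto simp: star_packing_def intro!: finite_subset[of _ "Pow V"])
  have "{} \<in> {K. ?P K}"
    by (auto simp: star_packing_def is_forest_empty intro!: exI[of _ "{}"])
  from finite_has_maximal2[OF finP this]
  obtain K where K: "K \<in> {K. ?P K}" and max: "\<forall>K'\<in>{K. ?P K}. K \<subseteq> K' \<longrightarrow> K = K'"
    by (elim bexE conjE)
  then obtain U F where P: "star_packing V E K U F" by auto
  then have U: "U \<subseteq> V" "card U \<le> 5 * card K" "K \<subseteq> U" by (auto simp: star_packing_def)
  have "5 \<le> card {e \<in> E. v \<in> e} + card {e \<in> E. v \<in> e \<and> e \<inter> U \<noteq> {}}" if v: "v \<in> V - U" for v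
  proof (rule ccontr)
    assume small: "\<not> ?thesis"
    \<comment> \<open>A weight of at most 4 bounds the degree by 4; as the edges into
      \<open>U\<close> are among all edges at \<open>v\<close>, there are at most 2 of them.\<close>
    have "card {e \<in> E. v \<in> e \<and> e \<inter> U \<noteq> {}} \<le> card {e \<in> E. v \<in> e}"
      by (rule card_mono) (use fin in auto)
    then have "?P (insert v K)"
      using small v by (intro star_packing_extend[OF fin E P]) auto
    with max have "K = insert v K" by (auto dest: bspec)
    then show False using U v by blast
  qed
  then have "card (V - U) * 5
      \<le> (\<Sum>v\<in>V - U. card {e \<in> E. v \<in> e} + card {e \<in> E. v \<in> e \<and> e \<inter> U \<noteq> {}})"
    using sum_bounded_below[of "V - U" "5 :: nat"] by simp
  also have "\<dots> \<le> 2 * card E"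
    using E by (intro weighted_degree_sum[OF fin]) auto
  finally have "5 * card (V - U) \<le> 2 * card E" by simp
  moreover have "card (V - U) = card V - card U"
    using U fin by (simp add: card_Diff_subset finite_subset)
  ultimately show ?thesis using that[OF P] U by linarith
qed

section \<open>A forest whose complement has no long path\<close>

lemma forest_avoiding_path_connected:
  assumes fin: "finite V" "finite E" and E: "\<And>e. e \<in> E \<Longrightarrow> e \<subseteq> V \<and> card e = 2"
    and conn: "\<And>X. X \<subseteq> V \<Longrightarrow> X \<noteq> {} \<Longrightarrow> X \<noteq> V \<Longrightarrow> \<exists>e\<in>E. crosses e X"
    and m: "22 * card E + 90 < 45 * n"
  shows "\<exists>T\<subseteq>E. is_forest T \<and> (\<forall>f. f ` {..<n} \<subseteq> V \<longrightarrow> \<not> path_in (E - T) n f)"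
proof -
  obtain K U F where P: "star_packing V E K U F" and card: "5 * card V \<le> 2 * card E + 25 * card K"
    using large_star_packing[OF fin E] by blast
  then have F: "is_forest F" "F \<subseteq> E" "K \<subseteq> V" "\<And>v. v \<in> K \<Longrightarrow> card {e \<in> E - F. v \<in> e} \<le> 1"
    by (auto simp: star_packing_def)
  obtain T where T: "is_forest T" "F \<subseteq> T" "T \<subseteq> E" "card V \<le> Suc (card T)"
    using forest_extends_to_spanning_tree[OF fin E conn F(1,2)] by blast
  have False if f: "f ` {..<n} \<subseteq> V" "path_in (E - T) n f" for f
  proof -
    have "card {e \<in> E - T. v \<in> e} \<le> 1" if "v \<in> K" for v
    proof -
      have "card {e \<in> E - T. v \<in> e} \<le> card {e \<in> E - F. v \<in> e}"
        by (rule card_mono) (use fin T in auto)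
      then show ?thesis using F(4)[OF that] by simp
    qed
    then have "card K + n \<le> card V + 2"
      using path_in_low_degree[OF f(2) _ fin(1) f(1) F(3)] fin by simp
    moreover have "n \<le> Suc (card (E - T))"
      using path_in_card_edges[OF f(2)] fin by simp
    moreover have "card (E - T) + card T = card E"
      using T fin by (metis card_Diff_subset card_mono finite_subset le_add_diff_inverse2)
    moreover have "n \<le> card V"
      using f fin card_inj_on_le[of f "{..<n}" V] by (simp add: path_in_def)
    \<comment> \<open>Put N = |V|, M = |E|, k = |K|. The facts give N + n \<le> M + 2, k + n \<le> N
      + 2 and 5N \<le> 2M + 25k. Hence 25n \<le> 2M + 20N + 50 \<le> 22M - 20n + 90, that is 45n
      \<le> 22M + 90.\<close>
    ultimately show False using card m T(4) by linarith
  qed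
  then show ?thesis using T by blast
qed

lemma path_in_one_side:
  assumes path: "path_in B n f" and cut: "\<And>e. e \<in> B \<Longrightarrow> \<not> crosses e X" and i: "i < n"
  shows "f i \<in> X \<longleftrightarrow> f 0 \<in> X"
  using i
proof (induction i)
  case (Suc i)
  then have "{f i, f (Suc i)} \<in> B" using path by (auto simp: path_in_def)
  then have "f i \<in> X \<longleftrightarrow> f (Suc i) \<in> X" using cut by (fastforce simp: crosses_def)
  then show ?case using Suc by auto
qed simp

text \<open>Induction along uncrossed cuts: both sides inherit the edge bound, their forests are
  vertex-disjoint, and a path stays on one side.\<close>

lemma forest_avoiding_path:
  assumes "finite V" "finite E" "\<And>e. e \<in> E \<Longrightarrow> e \<subseteq> V \<and> card e = 2" "22 * card E + 90 < 45 * n"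
  shows "\<exists>T\<subseteq>E. is_forest T \<and> (\<forall>f. f ` {..<n} \<subseteq> V \<longrightarrow> \<not> path_in (E - T) n f)"
  using assms
proof (induction "card V" arbitrary: V E rule: less_induct)
  case less
  show ?case
  proof (cases "\<exists>X. X \<subseteq> V \<and> X \<noteq> {} \<and> X \<noteq> V \<and> (\<forall>e\<in>E. \<not> crosses e X)")
    case False
    then show ?thesis
      using less.prems by (intro forest_avoiding_path_connected) blast+
  next
    case True
    then obtain X where X: "X \<subseteq> V" "X \<noteq> {}" "X \<noteq> V" "\<And>e. e \<in> E \<Longrightarrow> \<not> crosses e X" by blast
    have part: "\<exists>T\<subseteq>{e \<in> E. e \<subseteq> Y}. is_forest T \<and>
        (\<forall>f. f ` {..<n} \<subseteq> Y \<longrightarrow> \<not> path_in ({e \<in> E. e \<subseteq> Y} - T) n f)" if Y: "Y \<subset> V" for Y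
    proof (rule less.hyps)
      show "card Y < card V" using Y less.prems by (simp add: psubset_card_mono)
      show "finite Y" using Y less.prems finite_subset by blast
      have "card {e \<in> E. e \<subseteq> Y} \<le> card E" by (rule card_mono) (use less.prems in auto)
      then show "22 * card {e \<in> E. e \<subseteq> Y} + 90 < 45 * n" using less.prems by linarith
    qed (use less.prems in auto)
    obtain T1 where T1: "T1 \<subseteq> {e \<in> E. e \<subseteq> X}" "is_forest T1"
      "\<And>f. f ` {..<n} \<subseteq> X \<Longrightarrow> \<not> path_in ({e \<in> E. e \<subseteq> X} - T1) n f"
      using part[of X] X by blast
    obtain T2 where T2: "T2 \<subseteq> {e \<in> E. e \<subseteq> V - X}" "is_forest T2"
      "\<And>f. f ` {..<n} \<subseteq> V - X \<Longrightarrow> \<not> path_in ({e \<in> E. e \<subseteq> V - X} - T2) n f"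
      using part[of "V - X"] X by blast
    have "finite (\<Union>T1)" "finite (\<Union>T2)"
      using T1(1) T2(1) X(1) less.prems(1) by (auto intro!: finite_subset[of _ V])
    then have forest: "is_forest (T1 \<union> T2)"
      using T1(1,2) T2(1,2) by (intro is_forest_union) blast+
    have False if f: "f ` {..<n} \<subseteq> V" "path_in (E - (T1 \<union> T2)) n f" for f
    proof -
      have side: "f i \<in> X \<longleftrightarrow> f 0 \<in> X" if "i < n" for i
        using path_in_one_side[OF f(2) _ that] X(4) by blast
      have *: "path_in ({e \<in> E. e \<subseteq> Y} - T) n f"
        if "f ` {..<n} \<subseteq> Y" "T \<subseteq> T1 \<union> T2" for Y T
        using f(2) that unfolding path_in_def by (auto simp: image_subset_iff)
      show False
      proof (cases "f 0 \<in> X")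
        case True
        then have "f ` {..<n} \<subseteq> X" using side by auto
        then show False using T1(3) * by blast
      next
        case False
        then have "f ` {..<n} \<subseteq> V - X" using side f(1) by auto
        then show False using T2(3) * by blast
      qed
    qed
    moreover have "T1 \<union> T2 \<subseteq> E" using T1 T2 by blast
    ultimately show ?thesis using forest by blast
  qed
qed

section \<open>The Ramsey bound\<close>

text \<open>The cycle bound \<open>x\<close> is arbitrary, since a red forest contains no cycle of
  any length.\<close>

lemma ramsey_cycles_path_edges:
  fixes G :: "'a ugraph"
  assumes G: "simple_graph G" and arrows: "ramsey_arrows G (cycles_upto x) (path_graph n)"
  shows "45 * n \<le> 22 * card (edges G) + 90"
proof (rule ccontr)
  assume small: "\<not> ?thesis"
  have E: "finite (verts G)" "\<And>e. e \<in> edges G \<Longrightarrow> e \<subseteq> verts G \<and> card e = 2"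
    using G by (auto simp: simple_graph_def)
  then have "finite (edges G)" by (auto intro: finite_subset[of _ "Pow (verts G)"])
  then obtain T where T: "T \<subseteq> edges G" "is_forest T"
    "\<And>f. f ` {..<n} \<subseteq> verts G \<Longrightarrow> \<not> path_in (edges G - T) n f"
    using forest_avoiding_path[of "verts G" "edges G" n] E small by auto
  define \<chi> where "\<chi> e = (if e \<in> T then Red else Blue)" for e
  have red: False if F: "F \<in> cycles_upto x" and copy: "contains_copy (colour_subgraph G \<chi> Red) F" for F
  proof -
    obtain k where k: "3 \<le> k" "F = cycle_graph k" using F by (auto simp: cycles_upto_def)
    obtain f where f: "inj_on f {..<k}"
      "\<And>e. e \<in> {{i, Suc i mod k} | i. i < k} \<Longrightarrow> \<chi> (f ` e) = Red"
      using copy k by (auto simp: contains_copy_def colour_subgraph_def cycle_graph_def)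
    have "{f i, f (Suc i mod k)} \<in> T" if "i < k" for i
    proof -
      have "\<chi> (f ` {i, Suc i mod k}) = Red" using f(2) that by blast
      then show ?thesis by (simp add: \<chi>_def split: if_splits)
    qed
    then show False using is_forest_no_cycle[OF T(2) k(1) f(1)] by blast
  qed
  have blue: False if copy: "contains_copy (colour_subgraph G \<chi> Blue) (path_graph n)"
  proof -
    obtain f where f: "inj_on f {..<n}" "f ` {..<n} \<subseteq> verts G"
      "\<And>e. e \<in> {{i, Suc i} | i. Suc i < n} \<Longrightarrow> f ` e \<in> edges G \<and> \<chi> (f ` e) = Blue"
      using copy by (auto simp: contains_copy_def colour_subgraph_def path_graph_def)
    have "{f i, f (Suc i)} \<in> edges G - T" if "Suc i < n" for i
    proof -
      have "f ` {i, Suc i} \<in> edges G \<and> \<chi> (f ` {i, Suc i}) = Blue" using f(3) that by blast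
      then show ?thesis by (simp add: \<chi>_def split: if_splits)
    qed
    then have "path_in (edges G - T) n f" using f(1) by (simp add: path_in_def)
    then show False using T(3) f(2) by blast
  qed
  show False using arrows red blue unfolding ramsey_arrows_def by blast
qed

theorem theorem5p3:
  fixes c :: real
  assumes "c > 0"
  shows "\<forall>\<^sub>F n in sequentially.
    ereal_of_enat (size_ramsey (cycles_upto (c * real n)) (path_graph n)) \<ge> ereal (2.00365 * real n)"
proof (rule eventually_sequentiallyI)
  \<comment> \<open>As 22 * 2.00365 = 44.0803, the bound (45n - 90) / 22 suffices once 0.9197 n
    \<ge> 90, so from n = 98 on; 1000 is a round choice.\<close>
  fix n :: nat assume n: "1000 \<le> n"
  let ?A = "{enat (card (edges G)) | G :: nat ugraph.
    simple_graph G \<and> ramsey_arrows G (cycles_upto (c * real n)) (path_graph n)}"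
  show "ereal (2.00365 * real n)
    \<le> ereal_of_enat (size_ramsey (cycles_upto (c * real n)) (path_graph n))"
  proof (cases "?A = {}")
    case True
    then show ?thesis by (simp only: size_ramsey_def) (simp add: top_enat_def)
  next
    case False
    then obtain a where "a \<in> ?A" by (meson ex_in_conv)
    \<comment> \<open>Extended naturals are well-ordered, so the infimum is attained by an actual
      graph.\<close>
    then have "Inf ?A \<in> ?A" by (rule wellorder_InfI)
    then obtain G :: "nat ugraph" where G: "Inf ?A = enat (card (edges G))" "simple_graph G"
      "ramsey_arrows G (cycles_upto (c * real n)) (path_graph n)"
      unfolding mem_Collect_eq by (elim exE conjE)
    have "45 * real n \<le> 22 * real (card (edges G)) + 90"
      using ramsey_cycles_path_edges[OF G(2,3)] by linarith
    then have "2.00365 * real n \<le> real (card (edges G))" using n by simp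
    then show ?thesis by (simp only: size_ramsey_def G(1)) simp
  qed
qed

end
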